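(* Let $\Lambda=\{\lambda_j\}$ and $\Gamma=\{\gamma_j\}$ be Waterman sequences, and let $\{p_n\}_{n=1}^\infty$ and $\{q_n\}_{n=1}^\infty$ be sequences of real numbers with $1\le p_n\uparrow p\le\infty$ and $1\le q_n\uparrow q\le\infty$. If $$\sup_{1\leq n<\infty}\sum_{k=1}^\infty \Delta\Big(\frac1{\gamma_k}\Big)\max_{1\leq m\leq k}m\Lambda(m)^{-\frac{q_n}{p_n}}<\infty,$$ then $\Lambda \mathrm{BV}^{(p_n\uparrow p)}\subseteq \Gamma \mathrm{BV}^{(q_n\uparrow q)}$.
   Context: All functions are real-valued on a fixed compact interval $[a,b]$. For a subinterval $I$ of $[a,b]$, $f(I)=f(\sup I)-f(\inf I)$ and $|I|$ is its length. For a sequence $\{a_k\}$, $\Delta(a_k)=a_k-a_{k+1}$. Waterman sequence: a nondecreasing sequence $\Lambda=\{\lambda_j\}_{j=1}^\infty$ of positive numbers with $\sum_{j=1}^\infty\frac1{\lambda_j}=\infty$. Notation: $\Lambda(n)=\sum_{j=1}^n\frac1{\lambda_j}$. $1\le p_n\uparrow p\le\infty$ means that $\{p_n\}$ is a nondecreasing sequence of real numbers $\ge1$ with limit $p\in[1,\infty]$. $\Lambda\mathrm{BV}^{(p_n\uparrow p)}$ is the class of all $f$ on $[a,b]$ such that $$V_\Lambda(f;p_n\uparrow p):=\sup_{n\geq 1}\sup_{\{I_j\}}\Big(\sum_{j=1}^{s} \frac{|f(I_j)|^{p_n}}{\lambda_j}\Big)^{\frac{1}{p_n}}<\infty,$$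 where, for each $n$, the inner supremum is over all finite collections $\{I_j\}_{j=1}^s$ of nonoverlapping subintervals of $[a,b]$ with $\inf_j|I_j|\ge\frac{b-a}{2^n}$. The class $\Gamma\mathrm{BV}^{(q_n\uparrow q)}$ is defined in the same way with $\gamma_j$, $q_n$ in place of $\lambda_j$, $p_n$.
   Formalization: Adds the assumption that γ_j tends to infinity; without it the claim fails, e.g. on [0,1] with λ_j = γ_j = 1, p_n = n, q_n = 1 and the indicator function of the rationals. *)

theory Defs
  imports "HOL-Analysis.Analysis"
begin

(* All sequences are functions on nat that are only used at indices >= 1; the value at 0 is
   irrelevant.  A function on the compact interval [a,b] is a total function real => real of
   which only the values on {a..b} matter. *)

definition waterman_sum :: "(nat \<Rightarrow> real) \<Rightarrow> nat \<Rightarrow> real" where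
  "waterman_sum lam n = (\<Sum>j=1..n. 1 / lam j)"

(* Bounded sequences are allowed.  For bounded gam the sum over k of the differences of 1/gam_k
   telescopes to 1/gam_1 - lim 1/gam_j and loses the limit; if gam is constant it is zero
   whatever the other data are.  An embedding criterion expressed by this sum therefore needs the
   separate assumption that gam tends to infinity: for lam = gam = 1, p_n = n, q_n = 1 on [0,1]
   the sum vanishes, yet the indicator function of the rationals lies in the class of (lam, p)
   and not in that of (gam, q). *)
definition waterman_sequence :: "(nat \<Rightarrow> real) \<Rightarrow> bool" where
  "waterman_sequence lam \<longleftrightarrow>
     (\<forall>j\<ge>1. 0 < lam j) \<and> mono_on {1..} lam \<and> filterlim (waterman_sum lam) at_top sequentially"

definition seq_diff :: "(nat \<Rightarrow> real) \<Rightarrow> nat \<Rightarrow> real" where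
  "seq_diff u k = u k - u (Suc k)"

(* The relation 1 <= p_n \<up> P, where the limit P may be infinite. *)
definition exponents_up :: "(nat \<Rightarrow> real) \<Rightarrow> ereal \<Rightarrow> bool" where
  "exponents_up p P \<longleftrightarrow>
     (\<forall>n\<ge>1. 1 \<le> p n) \<and> mono_on {1..} p \<and> (\<lambda>n. ereal (p n)) \<longlonglongrightarrow> P"

definition interval_incr :: "(real \<Rightarrow> real) \<Rightarrow> real set \<Rightarrow> real" where
  "interval_incr f I = f (Sup I) - f (Inf I)"

definition interval_len :: "real set \<Rightarrow> real" where
  "interval_len I = Sup I - Inf I"

(* Subintervals may be open, closed or half-open; nonoverlapping means disjoint interiors. *)
definition admissible :: "real \<Rightarrow> real \<Rightarrow> nat \<Rightarrow> nat \<Rightarrow> (nat \<Rightarrow> real set) \<Rightarrow> bool" where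
  "admissible a b n s I \<longleftrightarrow>
     (\<forall>j\<in>{1..s}. is_interval (I j) \<and> I j \<noteq> {} \<and> I j \<subseteq> {a..b} \<and> (b - a) / 2 ^ n \<le> interval_len (I j)) \<and>
     (\<forall>i\<in>{1..s}. \<forall>j\<in>{1..s}. i \<noteq> j \<longrightarrow> interior (I i) \<inter> interior (I j) = {})"

definition total_var ::
  "real \<Rightarrow> real \<Rightarrow> (nat \<Rightarrow> real) \<Rightarrow> (nat \<Rightarrow> real) \<Rightarrow> (real \<Rightarrow> real) \<Rightarrow> ennreal" where
  "total_var a b lam p f =
     (SUP n\<in>{1..}. SUP (s, I)\<in>{(s, I). admissible a b n s I}.
        ennreal ((\<Sum>j=1..s. \<bar>interval_incr f (I j)\<bar> powr p n / lam j) powr (1 / p n)))"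

definition BV_class ::
  "real \<Rightarrow> real \<Rightarrow> (nat \<Rightarrow> real) \<Rightarrow> (nat \<Rightarrow> real) \<Rightarrow> (real \<Rightarrow> real) set" where
  "BV_class a b lam p = {f. total_var a b lam p f < \<infinity>}"

end

theory Submission
  imports Defs
begin

text \<open>
  Write \<open>\<Lambda>(m)\<close> for the partial sums of \<open>1/\<lambda>\<^sub>j\<close>, and fix \<open>n\<close> with \<open>r = q\<^sub>n/p\<^sub>n\<close>. The heart of the matter is
  a sharp estimate for a finite nonincreasing sequence \<open>y \<ge> 0\<close>:
  \<open>\<Sum>\<^bsub>j\<le>k\<^esub> y\<^sub>j\<^sup>r \<le> (max\<^bsub>m\<le>k\<^esub> m \<Lambda>(m)\<^sup>-\<^sup>r) (\<Sum>\<^bsub>j\<le>k\<^esub> y\<^sub>j/\<lambda>\<^sub>j)\<^sup>r\<close>.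
  The sequences that are constant up to some index \<open>m\<close> and zero afterwards give exactly the
  quantities under the maximum.
  For \<open>r \<ge> 1\<close> these step sequences are the extreme points for a convex function, and the estimate is
  a summation by parts combined with the fact that \<open>t \<mapsto> (t + h)\<^sup>r - t\<^sup>r\<close> is nondecreasing
  (\<open>sum_powr_le_convex_case\<close>). For \<open>r \<le> 1\<close> the constant sequence is the worst one, because
  of Jensen's and Chebyshev's inequalities (\<open>sum_powr_le_concave_case\<close>).

  Now let \<open>f\<close> have finite \<open>\<Lambda>\<close>-variation \<open>V\<close>. Every family of \<open>k\<close> intervals of length at least
  \<open>(b - a)/2\<^sup>n\<close> may be reordered so that the increments of \<open>f\<close> decrease in size, and the estimate with
  \<open>y\<^sub>j\<close> the \<open>p\<^sub>n\<close>-th power of \<open>\<bar>f(I\<^sub>j)\<bar>\<close> bounds the sum of the \<open>q\<^sub>n\<close>-th powers of the increments by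
  \<open>V\<close> to the power \<open>q\<^sub>n\<close> times \<open>max\<^bsub>m\<le>k\<^esub> m \<Lambda>(m)\<^sup>-\<^sup>r\<close> (\<open>sum_powr_incr_le\<close>). Since this sum does not depend on
  the order, the bound holds for every initial segment of every admissible family. Summation by
  parts against the weights \<open>1/\<gamma>\<^sub>j\<close>, which tend to zero, turns these bounds into the series of
  the hypothesis (\<open>weighted_sum_le_of_partial_sums\<close>). Taking \<open>q\<^sub>n\<close>-th roots costs only a factor
  \<open>max 1 S\<close>, where \<open>S\<close> is the supremum of the series, since \<open>q\<^sub>n \<ge> 1\<close>.
\<close>

section \<open>Summation by parts\<close>

lemma summation_by_parts:
  fixes z u :: "nat \<Rightarrow> real"
  shows "(\<Sum>j=1..n. z j * u j) =
    (\<Sum>k=1..n. seq_diff z k * (\<Sum>j=1..k. u j)) + z (Suc n) * (\<Sum>j=1..n. u j)"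
  by (induction n) (simp_all add: seq_diff_def algebra_simps)

lemma weighted_sum_mono_of_partial_sums:
  fixes z u w :: "nat \<Rightarrow> real"
  assumes z0: "\<And>j. j \<in> {1..n} \<Longrightarrow> 0 \<le> z j"
    and z: "antimono_on {1..n} z"
    and le: "\<And>k. k \<in> {1..n} \<Longrightarrow> (\<Sum>j=1..k. u j) \<le> (\<Sum>j=1..k. w j)"
  shows "(\<Sum>j=1..n. z j * u j) \<le> (\<Sum>j=1..n. z j * w j)"
proof -
  \<comment> \<open>Cutting \<open>z\<close> off after \<open>n\<close> removes the boundary term of the summation by parts.\<close>
  define z' where "z' j = (if j \<le> n then z j else 0)" for j
  have parts: "(\<Sum>j=1..n. z j * v j) = (\<Sum>k=1..n. seq_diff z' k * (\<Sum>j=1..k. v j))" for v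
  proof -
    have "(\<Sum>j=1..n. z j * v j) = (\<Sum>j=1..n. z' j * v j)"
      by (intro sum.cong) (auto simp: z'_def)
    also have "\<dots> = (\<Sum>k=1..n. seq_diff z' k * (\<Sum>j=1..k. v j))"
      by (subst summation_by_parts) (simp add: z'_def)
    finally show ?thesis .
  qed
  have "0 \<le> seq_diff z' k" if "k \<in> {1..n}" for k
    using that z0[of k] monotone_onD[OF z, of k "Suc k"] by (auto simp: seq_diff_def z'_def)
  then show ?thesis
    unfolding parts by (intro sum_mono mult_left_mono le) auto
qed

text \<open>
  After summation by parts up to \<open>N \<ge> s\<close> the boundary term is a fixed number times \<open>z\<^bsub>N+1\<^esub>\<close>,
  which vanishes in the limit. This is where a weight sequence that tends to zero is essential:
  the differences alone do not see the limit of \<open>z\<close>.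
\<close>

lemma weighted_sum_le_of_partial_sums:
  fixes z u M :: "nat \<Rightarrow> real"
  assumes lim: "z \<longlonglongrightarrow> 0"
    and z: "antimono_on {1..} z"
    and le: "\<And>k. 1 \<le> k \<Longrightarrow> (\<Sum>j=1..min k s. u j) \<le> c * M k"
    and S: "\<And>N. (\<Sum>k=1..N. seq_diff z k * M k) \<le> S" and c: "0 \<le> c"
  shows "(\<Sum>j=1..s. z j * u j) \<le> c * S"
proof -
  define u' where "u' j = (if j \<le> s then u j else 0)" for j
  have u': "(\<Sum>j=1..k. v j * u' j) = (\<Sum>j=1..min k s. v j * u j)" for v :: "nat \<Rightarrow> real" and k
    by (rule sum.mono_neutral_cong_right) (auto simp: u'_def)
  have bound: "(\<Sum>j=1..s. z j * u j) \<le> c * S + z (Suc N) * (\<Sum>j=1..s. u j)" if "s \<le> N" for N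
  proof -
    have "(\<Sum>j=1..s. z j * u j) = (\<Sum>j=1..N. z j * u' j)"
      using u'[where v = z and k = N] that by (simp add: min_absorb2)
    also have "\<dots> = (\<Sum>k=1..N. seq_diff z k * (\<Sum>j=1..min k s. u j)) + z (Suc N) * (\<Sum>j=1..s. u j)"
      using u'[where v = "\<lambda>_. 1"] that
      unfolding summation_by_parts[of z u'] by (simp add: min_absorb2)
    also have "(\<Sum>k=1..N. seq_diff z k * (\<Sum>j=1..min k s. u j))
        \<le> (\<Sum>k=1..N. seq_diff z k * (c * M k))"
      using z by (intro sum_mono mult_left_mono le) (auto simp: seq_diff_def monotone_on_def)
    also have "\<dots> = c * (\<Sum>k=1..N. seq_diff z k * M k)"
      by (simp add: sum_distrib_left mult_ac)
    also have "\<dots> \<le> c * S"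
      by (rule mult_left_mono[OF S c])
    finally show ?thesis by simp
  qed
  have "(\<lambda>N. c * S + z (Suc N) * (\<Sum>j=1..s. u j)) \<longlonglongrightarrow> c * S + 0 * (\<Sum>j=1..s. u j)"
    by (intro tendsto_intros LIMSEQ_Suc lim)
  then have "(\<lambda>N. c * S + z (Suc N) * (\<Sum>j=1..s. u j)) \<longlonglongrightarrow> c * S"
    by simp
  then show ?thesis
    by (rule Lim_bounded2[where N = s]) (use bound in auto)
qed

section \<open>Power sums of nonincreasing sequences\<close>

lemma powr_increment_mono:
  fixes r h x y :: real
  assumes r: "1 \<le> r" and h: "0 \<le> h" and xy: "0 \<le> x" "x \<le> y"
  shows "(x + h) powr r - x powr r \<le> (y + h) powr r - y powr r"
proof (rule DERIV_nonneg_imp_increasing_open[OF xy(2)])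
  fix t assume t: "x < t" "t < y"
  have "((\<lambda>t. (t + h) powr r - t powr r) has_real_derivative
      r * (t + h) powr (r - 1) - r * t powr (r - 1)) (at t)"
    using t xy h by (auto intro!: derivative_eq_intros)
  moreover have "0 \<le> r * (t + h) powr (r - 1) - r * t powr (r - 1)"
    using t xy h r by (auto intro!: mult_left_mono powr_mono2)
  ultimately show "\<exists>d. ((\<lambda>t. (t + h) powr r - t powr r) has_real_derivative d) (at t) \<and> 0 \<le> d"
    by blast
next
  show "continuous_on {x..y} (\<lambda>t. (t + h) powr r - t powr r)"
    using xy h r by (intro continuous_intros continuous_on_powr') auto
qed

lemma waterman_sum_Suc: "waterman_sum lam (Suc n) = waterman_sum lam n + 1 / lam (Suc n)"
  by (simp add: waterman_sum_def)

lemma waterman_sum_pos: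
  assumes "\<And>j. 1 \<le> j \<Longrightarrow> 0 < lam j" "1 \<le> n"
  shows "0 < waterman_sum lam n"
  unfolding waterman_sum_def using assms by (intro sum_pos) auto

text \<open>
  The increments of \<open>\<Lambda>(j)\<^sup>r\<close> are the weights for which the convex estimate is an equality on
  constant sequences. In the induction step, \<open>y\<^sub>k \<Lambda>(k-1)\<close> is at most the sum over the
  earlier indices, because \<open>y\<close> is nonincreasing; moving the base point of a power increment up to
  that sum can only enlarge the increment.
\<close>

lemma sum_powr_increments_le:
  fixes y lam :: "nat \<Rightarrow> real"
  assumes r: "1 \<le> r" and lam: "\<And>j. 1 \<le> j \<Longrightarrow> 0 < lam j"
    and y0: "\<And>j. j \<in> {1..k} \<Longrightarrow> 0 \<le> y j" and y: "antimono_on {1..k} y"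
  shows "(\<Sum>j=1..k. y j powr r * (waterman_sum lam j powr r - waterman_sum lam (j - 1) powr r))
    \<le> (\<Sum>j=1..k. y j / lam j) powr r"
  using y0 y
proof (induction k)
  case 0
  then show ?case by simp
next
  case (Suc k)
  let ?L = "waterman_sum lam" and ?T = "\<Sum>j=1..k. y j / lam j" and ?y = "y (Suc k)"
  have y: "0 \<le> ?y" and h: "0 \<le> 1 / lam (Suc k)" and L: "0 \<le> ?L k"
    using Suc.prems(1) lam
    by (auto simp: waterman_sum_def less_imp_le intro!: sum_nonneg divide_nonneg_pos)
  have yL: "?y * ?L k \<le> ?T"
    unfolding waterman_sum_def sum_distrib_left
    using Suc.prems lam by (auto intro!: sum_mono divide_right_mono simp: monotone_on_def less_imp_le)
  have "?y powr r * (?L (Suc k) powr r - ?L k powr r)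
      = (?y * ?L k + ?y / lam (Suc k)) powr r - (?y * ?L k) powr r"
    using y h L by (simp add: waterman_sum_Suc powr_mult right_diff_distrib flip: distrib_left)
      (simp add: powr_mult[symmetric] distrib_left)
  also have "\<dots> \<le> (?T + ?y / lam (Suc k)) powr r - ?T powr r"
    using y h L yL r lam[of "Suc k"] by (intro powr_increment_mono) auto
  finally have "?y powr r * (?L (Suc k) powr r - ?L k powr r)
      \<le> (?T + ?y / lam (Suc k)) powr r - ?T powr r" .
  moreover have "(\<Sum>j=1..k. y j powr r * (?L j powr r - ?L (j - 1) powr r)) \<le> ?T powr r"
    using Suc.prems by (intro Suc.IH) (auto simp: monotone_on_def)
  ultimately show ?case by simp
qed

text \<open>
  The bound \<open>m \<le> M \<Lambda>(m)\<^sup>r\<close> compares the partial sums of the constant sequence \<open>1\<close> with those of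
  \<open>M\<close> times the increments of \<open>\<Lambda>(j)\<^sup>r\<close>. As \<open>y\<^sub>j\<^sup>r\<close> is nonincreasing, the comparison survives
  the insertion of these weights.
\<close>

lemma sum_powr_le_convex_case:
  fixes y lam :: "nat \<Rightarrow> real"
  assumes r: "1 \<le> r" and lam: "\<And>j. 1 \<le> j \<Longrightarrow> 0 < lam j"
    and y0: "\<And>j. j \<in> {1..k} \<Longrightarrow> 0 \<le> y j" and y: "antimono_on {1..k} y"
    and M: "\<And>m. m \<in> {1..k} \<Longrightarrow> real m * waterman_sum lam m powr (- r) \<le> M" and k: "1 \<le> k"
  shows "(\<Sum>j=1..k. y j powr r) \<le> M * (\<Sum>j=1..k. y j / lam j) powr r"
proof -
  let ?L = "waterman_sum lam"
  have telescope: "(\<Sum>j=1..m. M * (?L j powr r - ?L (j - 1) powr r)) = M * ?L m powr r" for m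
    using r by (induction m) (simp_all add: waterman_sum_def algebra_simps)
  have M0: "0 \<le> M"
    using M[of 1] k by (auto intro: order_trans[rotated])
  have "(\<Sum>j=1..k. y j powr r * 1)
      \<le> (\<Sum>j=1..k. y j powr r * (M * (?L j powr r - ?L (j - 1) powr r)))"
  proof (rule weighted_sum_mono_of_partial_sums)
    show "antimono_on {1..k} (\<lambda>j. y j powr r)"
      using y y0 r by (auto simp: monotone_on_def intro!: powr_mono2)
    fix m assume m: "m \<in> {1..k}"
    then have "0 < ?L m"
      using waterman_sum_pos[of lam m] lam by auto
    then show "(\<Sum>j=1..m. 1) \<le> (\<Sum>j=1..m. M * (?L j powr r - ?L (j - 1) powr r))"
      unfolding telescope using M[OF m] by (simp add: powr_minus field_simps)
  qed auto
  also have "\<dots> = M * (\<Sum>j=1..k. y j powr r * (?L j powr r - ?L (j - 1) powr r))"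
    by (simp add: sum_distrib_left mult_ac)
  also have "\<dots> \<le> M * (\<Sum>j=1..k. y j / lam j) powr r"
    using M0 by (intro mult_left_mono sum_powr_increments_le r lam y0 y)
  finally show ?thesis by simp
qed

text \<open>
  This is Jensen's inequality for the concave function \<open>t \<mapsto> t\<^sup>r\<close>, including the endpoint \<open>0\<close>. It is
  the sum of Young's inequalities \<open>y\<^sub>j\<^sup>r A\<^bsup>1-r\<^esup> \<le> r y\<^sub>j + (1 - r) A\<close>, where \<open>A\<close> is the mean of \<open>y\<close>.
\<close>

lemma sum_powr_le_mean_powr:
  fixes y :: "nat \<Rightarrow> real"
  assumes r: "0 < r" "r \<le> 1" and k: "1 \<le> k" and y0: "\<And>j. j \<in> {1..k} \<Longrightarrow> 0 \<le> y j"
  shows "(\<Sum>j=1..k. y j powr r) \<le> real k * ((\<Sum>j=1..k. y j) / real k) powr r"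
proof (cases "(\<Sum>j=1..k. y j) = 0")
  case True
  then have "y j = 0" if "j \<in> {1..k}" for j
    using that y0 sum_nonneg_eq_0_iff[of "{1..k}" y] by blast
  then show ?thesis
    using r by simp
next
  case False
  define A where "A = (\<Sum>j=1..k. y j) / real k"
  have "0 < (\<Sum>j=1..k. y j)"
    using False y0 by (metis order_le_less sum_nonneg)
  then have A: "0 < A" and sum_y: "(\<Sum>j=1..k. y j) = real k * A"
    using k by (simp_all add: A_def)
  have young: "y j powr r * A powr (1 - r) \<le> r * y j + (1 - r) * A" if "j \<in> {1..k}" for j
  proof (cases "y j = 0")
    case True
    then show ?thesis using A r by simp
  next
    case False
    then show ?thesis
      using Youngs_inequality_0[of r "1 - r" "y j" A] A r y0[OF that] by simp
  qed
  have "(\<Sum>j=1..k. y j powr r) * A powr (1 - r) = (\<Sum>j=1..k. y j powr r * A powr (1 - r))"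
    by (simp add: sum_distrib_right)
  also have "\<dots> \<le> (\<Sum>j=1..k. r * y j + (1 - r) * A)"
    by (intro sum_mono young)
  also have "\<dots> = r * (\<Sum>j=1..k. y j) + real k * ((1 - r) * A)"
    by (simp add: sum.distrib sum_distrib_left)
  also have "\<dots> = real k * A"
    unfolding sum_y by (simp add: algebra_simps)
  also have "\<dots> = real k * A powr r * A powr (1 - r)"
    using A by (simp add: mult.assoc flip: powr_add)
  finally have "(\<Sum>j=1..k. y j powr r) \<le> real k * A powr r"
    by (rule mult_right_le_imp_le) (use A in simp)
  then show ?thesis
    by (simp add: A_def)
qed

lemma sum_powr_le_concave_case:
  fixes y lam :: "nat \<Rightarrow> real"
  assumes r: "0 < r" "r \<le> 1" and lam: "\<And>j. 1 \<le> j \<Longrightarrow> 0 < lam j" "mono_on {1..} lam"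
    and y0: "\<And>j. j \<in> {1..k} \<Longrightarrow> 0 \<le> y j" and y: "antimono_on {1..k} y" and k: "1 \<le> k"
  shows "(\<Sum>j=1..k. y j powr r)
    \<le> real k * waterman_sum lam k powr (- r) * (\<Sum>j=1..k. y j / lam j) powr r"
proof -
  let ?L = "waterman_sum lam k"
  have L: "0 < ?L"
    using waterman_sum_pos[of lam k] lam k by auto
  have shift: "(\<Sum>j=1..k. g j) = (\<Sum>j=0..<k. g (Suc j))" for g :: "nat \<Rightarrow> real"
    using sum.shift_bounds_Suc_ivl[of g 0 k] by (simp add: atLeastLessThanSuc_atLeastAtMost)
  \<comment> \<open>Both \<open>y\<close> and \<open>1/\<lambda>\<close> decrease, so they are positively correlated. The sign makes the second
    factor increasing.\<close>
  have "real k * (\<Sum>j=0..<k. (- (1 / lam (Suc j))) * y (Suc j))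
      \<le> (\<Sum>j=0..<k. - (1 / lam (Suc j))) * (\<Sum>j=0..<k. y (Suc j))"
  proof (rule Chebyshev_sum_upper)
    fix i j :: nat assume ij: "i \<le> j" "j < k"
    show "- (1 / lam (Suc i)) \<le> - (1 / lam (Suc j))"
      using lam(1)[of "Suc i"] lam(1)[of "Suc j"] monotone_onD[OF lam(2), of "Suc i" "Suc j"] ij
      by (simp add: frac_le)
    show "y (Suc j) \<le> y (Suc i)"
      using monotone_onD[OF y, of "Suc i" "Suc j"] ij by auto
  qed
  then have chebyshev: "?L * (\<Sum>j=1..k. y j) \<le> real k * (\<Sum>j=1..k. y j / lam j)"
    unfolding waterman_sum_def shift by (simp add: sum_negf)
  have T: "0 \<le> (\<Sum>j=1..k. y j / lam j)" and Y: "0 \<le> (\<Sum>j=1..k. y j)"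
    using y0 lam(1) by (auto intro!: sum_nonneg divide_nonneg_pos)
  have "(\<Sum>j=1..k. y j powr r) \<le> real k * ((\<Sum>j=1..k. y j) / real k) powr r"
    by (intro sum_powr_le_mean_powr r k y0)
  also have "\<dots> \<le> real k * ((\<Sum>j=1..k. y j / lam j) / ?L) powr r"
    using chebyshev L T Y k r by (intro mult_left_mono powr_mono2) (auto simp: field_simps)
  also have "\<dots> = real k * ?L powr (- r) * (\<Sum>j=1..k. y j / lam j) powr r"
    using L T by (simp add: powr_divide powr_minus field_simps)
  finally show ?thesis .
qed

lemma sum_powr_le_Max:
  fixes y lam :: "nat \<Rightarrow> real"
  assumes r: "0 < r" and lam: "\<And>j. 1 \<le> j \<Longrightarrow> 0 < lam j" "mono_on {1..} lam"
    and y0: "\<And>j. j \<in> {1..k} \<Longrightarrow> 0 \<le> y j" and y: "antimono_on {1..k} y" and k: "1 \<le> k"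
  shows "(\<Sum>j=1..k. y j powr r) \<le>
    Max ((\<lambda>m. real m * waterman_sum lam m powr (- r)) ` {1..k}) * (\<Sum>j=1..k. y j / lam j) powr r"
proof (cases "1 \<le> r")
  case True
  then show ?thesis
    by (intro sum_powr_le_convex_case lam(1) y0 y k) auto
next
  case False
  then have "(\<Sum>j=1..k. y j powr r)
      \<le> real k * waterman_sum lam k powr (- r) * (\<Sum>j=1..k. y j / lam j) powr r"
    using r by (intro sum_powr_le_concave_case lam y0 y k) auto
  also have "\<dots> \<le> Max ((\<lambda>m. real m * waterman_sum lam m powr (- r)) ` {1..k})
      * (\<Sum>j=1..k. y j / lam j) powr r"
    using k by (intro mult_right_mono Max_ge) auto
  finally show ?thesis .
qed

section \<open>Increments over admissible families\<close>

lemma ex_antimono_rearrangement: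
  fixes x :: "nat \<Rightarrow> real"
  shows "\<exists>\<sigma>. bij_betw \<sigma> {1..s} {1..s} \<and> antimono_on {1..s} (x \<circ> \<sigma>)"
proof -
  define xs where "xs = sort_key (\<lambda>i. - x i) [1..<Suc s]"
  have len: "length xs = s" and "set xs = {1..s}" "distinct xs"
    by (auto simp: xs_def)
  then have "bij_betw ((!) xs) {..<s} {1..s}"
    by (intro bij_betw_nth) auto
  moreover have "bij_betw (\<lambda>j. j - 1) {1..s} {..<s}"
    by (rule bij_betw_byWitness[where f' = Suc]) auto
  ultimately have "bij_betw ((!) xs \<circ> (\<lambda>j. j - 1)) {1..s} {1..s}"
    by (rule bij_betw_trans[rotated])
  moreover have "antimono_on {1..s} (x \<circ> ((!) xs \<circ> (\<lambda>j. j - 1)))"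
  proof (rule monotone_onI)
    fix i j assume ij: "i \<in> {1..s}" "j \<in> {1..s}" "i \<le> j"
    have "sorted (map (\<lambda>i. - x i) xs)"
      by (simp add: xs_def)
    then have "map (\<lambda>i. - x i) xs ! (i - 1) \<le> map (\<lambda>i. - x i) xs ! (j - 1)"
      using ij len by (intro sorted_nth_mono) auto
    then show "(x \<circ> ((!) xs \<circ> (\<lambda>j. j - 1))) j \<le> (x \<circ> ((!) xs \<circ> (\<lambda>j. j - 1))) i"
      using ij len by auto
  qed
  ultimately show ?thesis by blast
qed

lemma admissible_rearrange:
  assumes "admissible a b n s I" and \<sigma>: "bij_betw \<sigma> {1..s} {1..s}"
  shows "admissible a b n s (I \<circ> \<sigma>)"
proof -
  have "\<sigma> j \<in> {1..s}" if "j \<in> {1..s}" for j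
    using that bij_betwE[OF \<sigma>] by blast
  moreover have "\<sigma> i \<noteq> \<sigma> j" if "i \<in> {1..s}" "j \<in> {1..s}" "i \<noteq> j" for i j
    using that inj_onD[OF bij_betw_imp_inj_on[OF \<sigma>]] by blast
  ultimately show ?thesis
    using assms(1) by (simp add: admissible_def)
qed

lemma admissible_initial_segment:
  "admissible a b n s I \<Longrightarrow> k \<le> s \<Longrightarrow> admissible a b n k I"
  by (auto simp: admissible_def)

lemma sum_le_powr_total_var:
  assumes fin: "total_var a b lam p f < \<infinity>" and adm: "admissible a b n s I"
    and n: "1 \<le> n" and p: "1 \<le> p n" and lam: "\<And>j. 1 \<le> j \<Longrightarrow> 0 < lam j"
  shows "(\<Sum>j=1..s. \<bar>interval_incr f (I j)\<bar> powr p n / lam j)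
    \<le> enn2real (total_var a b lam p f) powr p n"
proof -
  let ?S = "\<Sum>j=1..s. \<bar>interval_incr f (I j)\<bar> powr p n / lam j"
  have S: "0 \<le> ?S"
    using lam by (intro sum_nonneg divide_nonneg_pos) auto
  have "ennreal (?S powr (1 / p n)) \<le> total_var a b lam p f"
    unfolding total_var_def using n adm by (intro SUP_upper2[of n] SUP_upper2[of "(s, I)"]) auto
  then have "?S powr (1 / p n) \<le> enn2real (total_var a b lam p f)"
    using enn2real_mono[of "ennreal (?S powr (1 / p n))"] fin by simp
  then have "(?S powr (1 / p n)) powr p n \<le> enn2real (total_var a b lam p f) powr p n"
    using p by (intro powr_mono2) auto
  then show ?thesis
    using p S by (simp add: powr_powr)
qed

text \<open>
  The left-hand side does not depend on the order of the intervals, whereas the weighted sum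
  that defines the variation does. Hence the intervals may be put in the order most favourable for
  the power sum estimate, namely that of decreasing increments.
\<close>

lemma sum_powr_incr_le:
  assumes fin: "total_var a b lam p f < \<infinity>" and adm: "admissible a b n k I"
    and n: "1 \<le> n" and k: "1 \<le> k" and p: "1 \<le> p n" and q: "0 < q"
    and lam: "\<And>j. 1 \<le> j \<Longrightarrow> 0 < lam j" "mono_on {1..} lam"
  shows "(\<Sum>j=1..k. \<bar>interval_incr f (I j)\<bar> powr q) \<le>
    enn2real (total_var a b lam p f) powr q *
    Max ((\<lambda>m. real m * waterman_sum lam m powr (- (q / p n))) ` {1..k})"
proof -
  let ?V = "enn2real (total_var a b lam p f)"
    and ?M = "Max ((\<lambda>m. real m * waterman_sum lam m powr (- (q / p n))) ` {1..k})"
  define x where "x j = \<bar>interval_incr f (I j)\<bar>" for j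
  obtain \<sigma> where \<sigma>: "bij_betw \<sigma> {1..k} {1..k}" and anti: "antimono_on {1..k} (x \<circ> \<sigma>)"
    using ex_antimono_rearrangement by blast
  define y where "y j = x (\<sigma> j) powr p n" for j
  have y: "antimono_on {1..k} y"
    using anti p by (auto simp: monotone_on_def y_def x_def intro!: powr_mono2)
  have le: "(\<Sum>j=1..k. y j / lam j) \<le> ?V powr p n"
    using sum_le_powr_total_var[OF fin admissible_rearrange[OF adm \<sigma>] n p lam(1)]
    by (simp add: y_def x_def)
  have T: "0 \<le> (\<Sum>j=1..k. y j / lam j)"
    using lam(1) by (intro sum_nonneg divide_nonneg_pos) (auto simp: y_def)
  have M: "0 \<le> ?M"
    using k by (intro order_trans[OF _ Max_ge[of _ "1 * waterman_sum lam 1 powr (- (q / p n))"]]) force+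
  have "(\<Sum>j=1..k. x j powr q) = (\<Sum>j=1..k. x (\<sigma> j) powr q)"
    by (rule sum.reindex_bij_betw[OF \<sigma>, symmetric])
  also have "\<dots> = (\<Sum>j=1..k. y j powr (q / p n))"
    using p by (simp add: y_def powr_powr)
  also have "\<dots> \<le> ?M * (\<Sum>j=1..k. y j / lam j) powr (q / p n)"
    using p q by (intro sum_powr_le_Max lam y k) (auto simp: y_def)
  also have "\<dots> \<le> ?M * (?V powr p n) powr (q / p n)"
    using M le T p q by (intro mult_left_mono powr_mono2) auto
  also have "\<dots> = ?V powr q * ?M"
    using p by (simp add: powr_powr)
  finally show ?thesis by (simp add: x_def)
qed

lemma ennreal_partial_sum_le:
  fixes g :: "nat \<Rightarrow> real"
  assumes B: "(\<Sum>k. ennreal (g (Suc k))) \<le> B" "B < \<infinity>" and g: "\<And>k. 0 \<le> g (Suc k)"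
  shows "(\<Sum>k=1..N. g k) \<le> enn2real B"
proof -
  have shift: "(\<Sum>k=1..N. g k) = (\<Sum>k<N. g (Suc k))"
    by (simp add: sum.atLeast1_atMost_eq)
  have "ennreal (\<Sum>k=1..N. g k) = (\<Sum>k<N. ennreal (g (Suc k)))"
    unfolding shift using g by (simp add: sum_ennreal)
  also have "\<dots> \<le> (\<Sum>k. ennreal (g (Suc k)))"
    by (rule sum_le_suminf) auto
  also have "\<dots> \<le> B" by (rule B)
  finally have "enn2real (ennreal (\<Sum>k=1..N. g k)) \<le> enn2real B"
    using B(2) by (intro enn2real_mono) auto
  moreover have "0 \<le> (\<Sum>k=1..N. g k)"
    unfolding shift using g by (intro sum_nonneg) auto
  ultimately show ?thesis by simp
qed

section \<open>The embedding\<close>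

theorem theorem2p12:
  fixes a b :: real and lam gam p q :: "nat \<Rightarrow> real" and P Q :: ereal
  assumes "a < b"
    and "waterman_sequence lam" and "waterman_sequence gam"
    and "filterlim gam at_top sequentially"
    and "exponents_up p P" and "exponents_up q Q"
    and "(SUP n\<in>{1..}. \<Sum>k. ennreal
           (seq_diff (\<lambda>j. 1 / gam j) (Suc k) *
            Max ((\<lambda>m. real m * waterman_sum lam m powr (- (q n / p n))) ` {1..Suc k}))) < \<infinity>"
  shows "BV_class a b lam p \<subseteq> BV_class a b gam q"
proof
  fix f assume "f \<in> BV_class a b lam p"
  then have fin: "total_var a b lam p f < \<infinity>"
    by (simp add: BV_class_def)
  define V where "V = enn2real (total_var a b lam p f)"
  define z where "z j = 1 / gam j" for j
  define M where "M n k = Max ((\<lambda>m. real m * waterman_sum lam m powr (- (q n / p n))) ` {1..k})" for n k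
  define B where "B = (SUP n\<in>{1..}. \<Sum>k. ennreal (seq_diff z (Suc k) * M n (Suc k)))"
  define S where "S = enn2real B"
  have B: "B < \<infinity>"
    using assms(7) unfolding B_def M_def z_def[abs_def] .
  have lam: "\<And>j. 1 \<le> j \<Longrightarrow> 0 < lam j" "mono_on {1..} lam"
    and gam: "\<And>j. 1 \<le> j \<Longrightarrow> 0 < gam j" "mono_on {1..} gam"
    using assms(2,3) by (auto simp: waterman_sequence_def)
  have pq: "1 \<le> p n" "1 \<le> q n" if "1 \<le> n" for n
    using assms(5,6) that by (auto simp: exponents_up_def)
  have z: "antimono_on {1..} z"
    using gam by (auto simp: monotone_on_def z_def intro!: frac_le)
  have z_lim: "z \<longlonglongrightarrow> 0"
    unfolding z_def
    by (rule tendsto_divide_0[OF tendsto_const filterlim_at_top_imp_at_infinity[OF assms(4)]])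
  have M_mono: "M n m \<le> M n k" if "1 \<le> m" "m \<le> k" for n m k
    unfolding M_def using that by (intro Max_mono) auto
  have M0: "0 \<le> M n k" if "1 \<le> k" for n k
  proof -
    have "0 \<le> M n 1" by (simp add: M_def)
    also have "\<dots> \<le> M n k" using that by (intro M_mono) auto
    finally show ?thesis .
  qed
  have S: "(\<Sum>k=1..N. seq_diff z k * M n k) \<le> S" if "1 \<le> n" for n N
    unfolding S_def
  proof (rule ennreal_partial_sum_le[OF _ B])
    show "(\<Sum>k. ennreal (seq_diff z (Suc k) * M n (Suc k))) \<le> B"
      unfolding B_def using that by (intro SUP_upper) auto
    show "0 \<le> seq_diff z (Suc k) * M n (Suc k)" for k
      using M0[of "Suc k" n] monotone_onD[OF z, of "Suc k" "Suc (Suc k)"]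
      by (simp add: seq_diff_def)
  qed
  have S0: "0 \<le> S" and V0: "0 \<le> V"
    by (simp_all add: S_def V_def)

  have bound: "(\<Sum>j=1..s. \<bar>interval_incr f (I j)\<bar> powr q n / gam j) powr (1 / q n) \<le> V * max 1 S"
    if n: "1 \<le> n" and adm: "admissible a b n s I" for n s I
  proof -
    let ?x = "\<lambda>j. \<bar>interval_incr f (I j)\<bar> powr q n"
    have "(\<Sum>j=1..s. z j * ?x j) \<le> V powr q n * S"
    proof (rule weighted_sum_le_of_partial_sums[where M = "M n", OF z_lim z _ S[OF n]])
      fix k :: nat assume k: "1 \<le> k"
      show "(\<Sum>j=1..min k s. ?x j) \<le> V powr q n * M n k"
      proof (cases "s = 0")
        case True
        then show ?thesis using M0[OF k] by simp
      next
        case False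
        have "(\<Sum>j=1..min k s. ?x j) \<le> V powr q n * M n (min k s)"
          unfolding V_def M_def using k False pq[OF n] n lam adm
          by (intro sum_powr_incr_le fin admissible_initial_segment[OF adm]) auto
        also have "\<dots> \<le> V powr q n * M n k"
          using k False by (intro mult_left_mono M_mono) auto
        finally show ?thesis .
      qed
    qed auto
    then have "(\<Sum>j=1..s. ?x j / gam j) \<le> V powr q n * S"
      by (simp add: z_def)
    then have "(\<Sum>j=1..s. ?x j / gam j) powr (1 / q n) \<le> (V powr q n * S) powr (1 / q n)"
      using pq[OF n] gam(1) by (intro powr_mono2 sum_nonneg divide_nonneg_pos) auto
    also have "\<dots> = V * S powr (1 / q n)"
      using pq[OF n] S0 V0 by (simp add: powr_mult powr_powr)
    also have "S powr (1 / q n) \<le> max 1 S powr (1 / q n)"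
      using pq[OF n] S0 by (intro powr_mono2) auto
    also have "\<dots> \<le> max 1 S powr 1"
      using pq[OF n] by (intro powr_mono) auto
    finally show ?thesis
      using V0 by (simp add: mult_left_mono)
  qed
  have "total_var a b gam q f \<le> ennreal (V * max 1 S)"
    unfolding total_var_def using bound by (auto intro!: SUP_least ennreal_leI)
  also have "\<dots> < \<infinity>" by simp
  finally show "f \<in> BV_class a b gam q"
    by (simp add: BV_class_def)
qed

end
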